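(* Let $p$ be a prime. For any positive integer $\ell$ and any pattern $\alpha=(a_1, \ldots, a_k)\in \left(\mathbb F_p\cup\{\star\}\right)^k$ with $k\ge 2\ell$ such that $a_\ell\ne 0$ and $a_{\ell+1}=\cdots= a_k=0$, we have $f_\alpha(p, n) = \Theta( n^{1/\ell})$. Moreover, if $a_\ell=1$ or $a_\ell=\star$, then $f_\alpha(p, n) \sim (\ell!\, n)^{1/\ell}$.
   Context: Let $[n]=\{1,\ldots,n\}$. For a prime $p$ and $\alpha=(a_1,\ldots,a_k)\in(\mathbb F_p\cup\{\star\})^k$, where $\star$ is a formal symbol (so $\star\neq 0$), a family $\mathcal F\subset 2^{[n]}$ is $\alpha$-intersecting modulo $p$ if for each $i\in[k]$ and any $i$ distinct members $F_1,\ldots,F_i\in\mathcal F$: if $a_i\in\mathbb F_p$ then $|F_1\cap\cdots\cap F_i|\equiv a_i\pmod p$, and if $a_i=\star$ then $|F_1\cap\cdots\cap F_i|\not\equiv 0\pmod p$. Let $f_\alpha(p,n)$ be the maximum size of an $\alpha$-intersecting family $\mathcal F\subset 2^{[n]}$ modulo $p$. Asymptotics are as $n\to\infty$ with $p,k,\alpha$ fixed: $f=O(g)$ means there is a constant $c>0$ with $f(n)\le c\,g(n)$ for all sufficiently large $n$; $f=\Theta(g)$ means $f=O(g)$ and $g=O(f)$; $f\sim g$ means $\lim_{n\to\infty}f(n)/g(n)=1$. *)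

theory Defs
  imports Complex_Main "HOL-Library.Landau_Symbols" "HOL-Number_Theory.Cong"
    "HOL-Computational_Algebra.Primes"
begin

text \<open>
  An entry of a pattern: an element of the prime field with \<open>p\<close> elements, given by its canonical
  representative in \<open>{0..<p}\<close>, or the formal symbol \<open>Star\<close>, which is different from \<open>Res 0\<close>.
\<close>
datatype entry = Res nat | Star

definition entries :: "nat \<Rightarrow> entry set" where
  "entries p = insert Star (Res ` {0..<p})"

fun entry_holds :: "nat \<Rightarrow> entry \<Rightarrow> nat \<Rightarrow> bool" where
  "entry_holds p (Res a) m \<longleftrightarrow> [m = a] (mod p)"
| "entry_holds p Star m \<longleftrightarrow> \<not> [m = 0] (mod p)"

text \<open>
  A pattern of length \<open>k\<close> is a function on \<open>{1..k}\<close>; its values elsewhere are irrelevant.  A choice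
  of \<open>i\<close> distinct members of \<open>\<F>\<close> is a subfamily \<open>\<G> \<subseteq> \<F>\<close> with \<open>card \<G> = i\<close>; since \<open>i \<ge> 1\<close>, such a
  subfamily is finite and nonempty.
\<close>
definition intersecting_mod :: "nat \<Rightarrow> nat \<Rightarrow> (nat \<Rightarrow> entry) \<Rightarrow> nat set set \<Rightarrow> bool" where
  "intersecting_mod p k \<alpha> \<F> \<longleftrightarrow>
     (\<forall>i\<in>{1..k}. \<forall>\<G>. \<G> \<subseteq> \<F> \<and> card \<G> = i \<longrightarrow> entry_holds p (\<alpha> i) (card (\<Inter>\<G>)))"

definition max_intersecting :: "nat \<Rightarrow> nat \<Rightarrow> (nat \<Rightarrow> entry) \<Rightarrow> nat \<Rightarrow> nat" where
  "max_intersecting p k \<alpha> n =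
     Max (card ` {\<F>. \<F> \<subseteq> Pow {1..n} \<and> intersecting_mod p k \<alpha> \<F>})"

text \<open>The maximum is taken over a finite nonempty set, hence attained.\<close>
lemma max_intersecting_attained:
  "\<exists>\<F>. \<F> \<subseteq> Pow {1..n} \<and> intersecting_mod p k \<alpha> \<F> \<and> card \<F> = max_intersecting p k \<alpha> n"
proof -
  define S where "S = {\<F>. \<F> \<subseteq> Pow {1..n} \<and> intersecting_mod p k \<alpha> \<F>}"
  have S_iff: "\<F> \<in> S \<longleftrightarrow> \<F> \<subseteq> Pow {1..n} \<and> intersecting_mod p k \<alpha> \<F>" for \<F>
    unfolding S_def by (rule mem_Collect_eq)
  have "finite (Pow (Pow {1..n}))"
    by (simp only: finite_Pow_iff finite_atLeastAtMost)
  moreover have "S \<subseteq> Pow (Pow {1..n})"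
    using S_iff by blast
  ultimately have fin: "finite S"
    by (rule rev_finite_subset)
  have "intersecting_mod p k \<alpha> {}"
    unfolding intersecting_mod_def
    by (metis atLeastAtMost_iff card.empty not_one_le_zero subset_empty)
  then have "S \<noteq> {}"
    using S_iff by blast
  then have "Max (card ` S) \<in> card ` S"
    using fin by (intro Max_in finite_imageI) blast+
  then obtain \<F> where "\<F> \<in> S" "Max (card ` S) = card \<F>"
    by blast
  then show ?thesis
    using S_iff unfolding max_intersecting_def S_def[symmetric] by metis
qed

end

theory Submission imports Defs "HOL-Library.FuncSet" begin

text \<open>
  Upper bound: modulo \<open>p\<close>, the indicator vectors of the \<open>l\<close>-wise intersections are pairwise
  orthogonal and not self-orthogonal, hence independent; so \<open>|\<F>| choose l \<le> n\<close>.

  Lower bound: prescribe the number of points in every region of the Venn diagram of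
  \<open>F\<^sub>1, \<dots>, F\<^sub>m\<close>. A region inside exactly \<open>l\<close> of the sets gets \<open>a\<^sub>l\<close> points (one point for
  \<open>Star\<close>), a region inside more sets is empty, and the regions inside fewer sets get, by downward
  induction, fewer than \<open>p\<close> points each to correct the residues. This uses
  \<open>a\<^sub>l m\<^sup>l / l! + O(m\<^sup>l\<^sup>-\<^sup>1)\<close> points.
\<close>

section \<open>Upper bound\<close>

text \<open>Pairing a linear combination of the indicator vectors with that of \<open>A j\<close>
  isolates the coefficient at \<open>j\<close>, so the vectors are independent over the prime field.
  Independence enters as a count: \<open>p ^ card I\<close> combinations are distinct among
  \<open>p ^ card X\<close> vectors.\<close>

lemma card_le_if_orthogonal_mod_prime:
  fixes A :: "'i \<Rightarrow> 'a set"
  assumes p: "prime p" and fI: "finite I" and fX: "finite X"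
    and sub: "\<And>i. i \<in> I \<Longrightarrow> A i \<subseteq> X"
    and diag: "\<And>i. i \<in> I \<Longrightarrow> \<not> p dvd card (A i)"
    and off: "\<And>i j. i \<in> I \<Longrightarrow> j \<in> I \<Longrightarrow> i \<noteq> j \<Longrightarrow> p dvd card (A i \<inter> A j)"
  shows "card I \<le> card X"
proof -
  \<comment> \<open>The combination with coefficients \<open>c\<close>, reduced modulo
    \<open>p\<close>; \<open>restrict\<close> places it in the finite function space on
    \<open>X\<close>.\<close>
  define \<phi> where "\<phi> c = restrict (\<lambda>x. (\<Sum>i\<in>I. if x \<in> A i then c i else 0) mod p) X"
    for c :: "'i \<Rightarrow> nat"
  have p0: "p > 0" using p by (rule prime_gt_0_nat)
  have pair: "[(\<Sum>x\<in>A j. \<Sum>i\<in>I. if x \<in> A i then c i else 0) = c j * card (A j)] (mod p)"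
    if j: "j \<in> I" for c :: "'i \<Rightarrow> nat" and j
  proof -
    have "(\<Sum>x\<in>A j. \<Sum>i\<in>I. if x \<in> A i then c i else 0)
        = (\<Sum>i\<in>I. \<Sum>x\<in>A j. if x \<in> A i then c i else 0)"
      by (rule sum.swap)
    also have "\<dots> = (\<Sum>i\<in>I. c i * card (A j \<inter> A i))"
    proof (rule sum.cong[OF refl])
      fix i
      have "finite (A j)" using sub[OF j] fX finite_subset by blast
      then have "(\<Sum>x\<in>A j. if x \<in> A i then c i else 0) = (\<Sum>x\<in>A j \<inter> A i. c i)"
        by (rule sum.inter_restrict[symmetric])
      then show "(\<Sum>x\<in>A j. if x \<in> A i then c i else 0) = c i * card (A j \<inter> A i)"
        by (simp add: mult.commute)
    qed
    also have "\<dots> = c j * card (A j) + (\<Sum>i\<in>I - {j}. c i * card (A j \<inter> A i))"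
      using fI j by (simp add: sum.remove)
    finally have eq: "(\<Sum>x\<in>A j. \<Sum>i\<in>I. if x \<in> A i then c i else 0)
        = c j * card (A j) + (\<Sum>i\<in>I - {j}. c i * card (A j \<inter> A i))" .
    have "p dvd (\<Sum>i\<in>I - {j}. c i * card (A j \<inter> A i))"
      using off[OF j] by (intro dvd_sum dvd_mult) auto
    then have "[c j * card (A j) + (\<Sum>i\<in>I - {j}. c i * card (A j \<inter> A i)) = c j * card (A j) + 0] (mod p)"
      by (intro cong_add cong_refl) (simp add: cong_0_iff)
    then show ?thesis unfolding eq by simp
  qed
  have "inj_on \<phi> (I \<rightarrow>\<^sub>E {..<p})"
  proof (rule inj_onI)
    fix c d assume c: "c \<in> I \<rightarrow>\<^sub>E {..<p}" and d: "d \<in> I \<rightarrow>\<^sub>E {..<p}" and eq: "\<phi> c = \<phi> d"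
    have "c j = d j" if j: "j \<in> I" for j
    proof -
      have "[(\<Sum>x\<in>A j. \<Sum>i\<in>I. if x \<in> A i then c i else 0)
          = (\<Sum>x\<in>A j. \<Sum>i\<in>I. if x \<in> A i then d i else 0)] (mod p)"
      proof (rule cong_sum)
        fix x assume "x \<in> A j"
        then have "x \<in> X" using sub[OF j] by blast
        then show "[(\<Sum>i\<in>I. if x \<in> A i then c i else 0)
            = (\<Sum>i\<in>I. if x \<in> A i then d i else 0)] (mod p)"
          using fun_cong[OF eq, of x] by (simp add: \<phi>_def cong_def)
      qed
      then have "[c j * card (A j) = d j * card (A j)] (mod p)"
        using cong_trans[OF cong_sym[OF pair[OF j]] cong_trans[OF _ pair[OF j]]] by blast
      moreover have "coprime (card (A j)) p"
        using prime_imp_coprime[OF p diag[OF j]] by (simp add: coprime_commute)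
      ultimately have "[c j = d j] (mod p)"
        by (simp add: cong_mult_rcancel_nat)
      then show ?thesis
        using PiE_mem[OF c j] PiE_mem[OF d j] by (simp add: cong_def)
    qed
    then show "c = d" using c d by (intro PiE_ext)
  qed
  moreover have "\<phi> ` (I \<rightarrow>\<^sub>E {..<p}) \<subseteq> X \<rightarrow>\<^sub>E {..<p}"
    using p0 by (auto simp: \<phi>_def)
  moreover have "finite (X \<rightarrow>\<^sub>E {..<p})"
    using fX by (simp add: finite_PiE)
  ultimately have "card (I \<rightarrow>\<^sub>E {..<p}) \<le> card (X \<rightarrow>\<^sub>E {..<p})"
    by (rule card_inj_on_le)
  then have "p ^ card I \<le> p ^ card X"
    using fI fX by (simp add: card_PiE)
  then show ?thesis
    using prime_gt_1_nat[OF p] by simp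
qed

text \<open>The right-hand side is the product of \<open>m + 1\<close> up to \<open>m + l\<close>,
  each factor exceeding \<open>m\<close>.\<close>

lemma power_le_fact_mult_binomial: "m ^ l \<le> fact l * ((m + l) choose l)"
proof (induction l)
  case (Suc l)
  have "fact (Suc l) * ((m + Suc l) choose Suc l) = fact l * (Suc l * (Suc (m + l) choose Suc l))"
    by (simp add: algebra_simps)
  also have "\<dots> = Suc (m + l) * (fact l * ((m + l) choose l))"
    by (simp only: Suc_times_binomial mult.left_commute)
  also have "\<dots> \<ge> m * m ^ l"
    using Suc by (intro mult_le_mono) auto
  finally show ?case by simp
qed simp

text \<open>Membership in \<open>entries\<close> makes the representative canonical:
  \<open>Res p\<close> differs from \<open>Res 0\<close>, yet would force divisibility.\<close>

lemma entry_holds_nonzero: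
  assumes "e \<in> entries p" "e \<noteq> Res 0" "entry_holds p e m"
  shows "\<not> p dvd m"
proof
  assume dvd: "p dvd m"
  from assms(1) consider "e = Star" | a where "e = Res a" "a < p" by (auto simp: entries_def)
  then show False
  proof cases
    case 1
    then show ?thesis using assms(3) dvd by (simp add: cong_0_iff)
  next
    case 2
    then have "m mod p = a" using assms(3) by (simp add: cong_def)
    then show ?thesis using dvd 2 assms(2) by simp
  qed
qed

text \<open>Orthogonality is applied to the intersections of the \<open>l\<close>-element
  subfamilies: the entry at \<open>l\<close> gives the diagonal condition, the zero entries the
  off-diagonal one.\<close>

lemma choose_card_intersecting_le:
  assumes p: "prime p" and l: "l \<ge> 1" and k: "k \<ge> 2 * l"
    and ent: "\<alpha> l \<in> entries p" and nz: "\<alpha> l \<noteq> Res 0"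
    and z: "\<forall>i\<in>{l+1..k}. \<alpha> i = Res 0"
    and F: "\<F> \<subseteq> Pow {1..n}" and int: "intersecting_mod p k \<alpha> \<F>"
  shows "card \<F> choose l \<le> n"
proof -
  have finF: "finite \<F>" using F finite_subset by blast
  define I where "I = {\<G>. \<G> \<subseteq> \<F> \<and> card \<G> = l}"
  have finI: "finite I" unfolding I_def using finF by simp
  have holds: "entry_holds p (\<alpha> (card \<G>)) (card (\<Inter>\<G>))"
    if "\<G> \<subseteq> \<F>" "card \<G> \<in> {1..k}" for \<G>
    using int that unfolding intersecting_mod_def by blast
  have "card I \<le> card {1..n}"
  proof (rule card_le_if_orthogonal_mod_prime[OF p finI, of _ Inter])
    fix \<G> assume "\<G> \<in> I"
    then have G: "\<G> \<subseteq> \<F>" "card \<G> = l" by (auto simp: I_def)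
    with l have "\<G> \<noteq> {}" by auto
    with G F show "\<Inter>\<G> \<subseteq> {1..n}" by blast
    show "\<not> p dvd card (\<Inter>\<G>)"
      using holds[of \<G>] G l k entry_holds_nonzero[OF ent nz] by simp
  next
    fix \<G> \<H> assume "\<G> \<in> I" "\<H> \<in> I" and ne: "\<G> \<noteq> \<H>"
    then have GH: "\<G> \<subseteq> \<F>" "card \<G> = l" "\<H> \<subseteq> \<F>" "card \<H> = l" by (auto simp: I_def)
    then have fin: "finite \<G>" "finite \<H>" using finF finite_subset by blast+
    \<comment> \<open>The union of two distinct \<open>l\<close>-element subfamilies has between
      \<open>l + 1\<close> and \<open>2 * l\<close> members, so \<open>k \<ge> 2 * l\<close> puts
      its entry among the zeros.\<close>
    have "card (\<G> \<union> \<H>) \<le> 2 * l" using card_Un_le[of \<G> \<H>] GH by simp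
    moreover have "\<not> \<H> \<subseteq> \<G>" using GH fin ne by (metis card_subset_eq)
    then have "\<G> \<subset> \<G> \<union> \<H>" by blast
    then have "l < card (\<G> \<union> \<H>)" using psubset_card_mono[of "\<G> \<union> \<H>" \<G>] fin GH by simp
    ultimately have "card (\<G> \<union> \<H>) \<in> {l+1..k}" using k by simp
    moreover from this have "card (\<G> \<union> \<H>) \<in> {1..k}" by simp
    then have "entry_holds p (\<alpha> (card (\<G> \<union> \<H>))) (card (\<Inter>(\<G> \<union> \<H>)))"
      using GH by (intro holds) auto
    ultimately have "[card (\<Inter>(\<G> \<union> \<H>)) = 0] (mod p)" using z by simp
    then show "p dvd card (\<Inter>\<G> \<inter> \<Inter>\<H>)"
      by (simp add: Inter_Un_distrib cong_0_iff)
  qed simp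
  then show ?thesis
    using n_subsets[OF finF, of l] by (simp add: I_def)
qed

section \<open>Lower bound\<close>

text \<open>\<open>x S\<close> stands for the number of points lying in exactly the sets indexed by
  \<open>S\<close>, so the sum over supersets of \<open>T\<close> is the size of the intersection
  indexed by \<open>T\<close>. The induction is on the number \<open>d\<close> of levels below
  \<open>l\<close> treated so far: changing \<open>x\<close> on sets of one size leaves the sums for
  all larger \<open>T\<close> intact.\<close>

lemma Venn_region_sizes:
  fixes b :: "nat \<Rightarrow> nat" and X :: "'a set"
  assumes p: "p > 0" and X: "finite X"
  shows "\<exists>x. (\<forall>S. card S = l \<longrightarrow> x S = c) \<and> (\<forall>S. card S < l \<longrightarrow> x S < p) \<and>
    (\<forall>S. card S > l \<longrightarrow> x S = (0::nat)) \<and>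
    (\<forall>T\<subseteq>X. l \<le> card T + d \<and> card T < l \<longrightarrow>
       [(\<Sum>S | T \<subseteq> S \<and> S \<subseteq> X. x S) = b (card T)] (mod p))"
proof (induction d)
  case 0
  show ?case
    \<comment> \<open>For \<open>d = 0\<close> no \<open>T\<close> is constrained, and zero
      satisfies the bound below \<open>p\<close>.\<close>
    by (rule exI[of _ "\<lambda>S. if card S = l then c else 0"]) (use p in auto)
next
  case (Suc d)
  then obtain x where x: "\<And>S. card S = l \<Longrightarrow> x S = c" "\<And>S. card S < l \<Longrightarrow> x S < p"
    "\<And>S. card S > l \<Longrightarrow> x S = 0"
    and cg: "\<And>T. T \<subseteq> X \<Longrightarrow> l \<le> card T + d \<Longrightarrow> card T < l \<Longrightarrow>
       [(\<Sum>S | T \<subseteq> S \<and> S \<subseteq> X. x S) = b (card T)] (mod p)"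
    by blast
  define \<sigma> where "\<sigma> T = (\<Sum>S | T \<subset> S \<and> S \<subseteq> X. x S)" for T
  \<comment> \<open>The factor \<open>p - 1\<close> acts as -1 within the naturals: the new value is
    the residue of \<open>b (card S)\<close> minus \<open>\<sigma> S\<close>.\<close>
  define x' where
    "x' S = (if card S + Suc d = l then (b (card S) + (p - 1) * \<sigma> S) mod p else x S)" for S
  have same: "x' S = x S" if "card T + Suc d \<ge> l" "T \<subset> S" "S \<subseteq> X" for S T
  proof -
    have "finite S" using that X finite_subset by blast
    then have "card T < card S" using that(2) by (rule psubset_card_mono)
    with that show ?thesis by (simp add: x'_def)
  qed
  have split: "(\<Sum>S | T \<subseteq> S \<and> S \<subseteq> X. y S) = y T + (\<Sum>S | T \<subset> S \<and> S \<subseteq> X. y S)"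
    if "T \<subseteq> X" for T and y :: "'a set \<Rightarrow> nat"
  proof -
    have "{S. T \<subseteq> S \<and> S \<subseteq> X} = insert T {S. T \<subset> S \<and> S \<subseteq> X}" using that by blast
    moreover have "finite {S. T \<subset> S \<and> S \<subseteq> X}"
      by (rule finite_subset[of _ "Pow X"]) (use X in auto)
    ultimately show ?thesis by simp
  qed
  have cong: "[(\<Sum>S | T \<subseteq> S \<and> S \<subseteq> X. x' S) = b (card T)] (mod p)"
    if T: "T \<subseteq> X" "l \<le> card T + Suc d" "card T < l" for T
  proof -
    have \<sigma>: "(\<Sum>S | T \<subset> S \<and> S \<subseteq> X. x' S) = \<sigma> T"
      unfolding \<sigma>_def using same[OF T(2)] by (intro sum.cong) auto
    show ?thesis
    proof (cases "card T + Suc d = l")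
      case True
      have "b (card T) + (p - 1) * \<sigma> T + \<sigma> T = b (card T) + p * \<sigma> T"
        using p by (cases p) auto
      then have "(b (card T) + (p - 1) * \<sigma> T + \<sigma> T) mod p = b (card T) mod p"
        by (simp only: mod_mult_self2)
      then have "[(b (card T) + (p - 1) * \<sigma> T) mod p + \<sigma> T = b (card T)] (mod p)"
        by (simp add: cong_def mod_add_left_eq)
      with True show ?thesis unfolding split[OF T(1)] \<sigma> by (simp add: x'_def)
    next
      case False
      then have "x' T = x T" by (simp add: x'_def)
      moreover have "[(\<Sum>S | T \<subseteq> S \<and> S \<subseteq> X. x S) = b (card T)] (mod p)"
        using cg T False by simp
      ultimately show ?thesis unfolding split[OF T(1)] \<sigma> by (simp add: \<sigma>_def)
    qed
  qed
  show ?case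
    by (rule exI[of _ x']) (use x cong p in \<open>auto simp: x'_def\<close>)
qed

text \<open>Regions are grouped by level. Level \<open>l\<close> gives the main term; each of the
  \<open>l\<close> lower levels has at most \<open>card X ^ (l - 1)\<close> regions, as
  \<open>X\<close> is nonempty, with fewer than \<open>p\<close> points each.\<close>

lemma sum_Venn_region_sizes_le:
  fixes x :: "'a set \<Rightarrow> nat"
  assumes X: "finite X" "X \<noteq> {}"
    and x: "\<And>S. card S = l \<Longrightarrow> x S = c" "\<And>S. card S < l \<Longrightarrow> x S < p"
      "\<And>S. card S > l \<Longrightarrow> x S = 0"
  shows "(\<Sum>S\<in>Pow X. x S) \<le> c * (card X choose l) + l * p * card X ^ (l - 1)"
proof -
  have lt: "(\<Sum>S | S \<subseteq> X \<and> card S = i. x S) \<le> p * card X ^ (l - 1)" if i: "i < l" for i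
  proof -
    have "(\<Sum>S | S \<subseteq> X \<and> card S = i. x S) \<le> (\<Sum>S | S \<subseteq> X \<and> card S = i. p)"
      using x(2) i by (intro sum_mono) (auto intro: less_imp_le)
    also have "\<dots> = (card X choose i) * p"
      using X by (simp add: n_subsets)
    also have "card X choose i \<le> card X ^ i"
      by (rule order.trans[OF _ binomial_fact_pow]) simp
    also have "card X ^ i \<le> card X ^ (l - 1)"
      using X i by (intro power_increasing) (auto simp: Suc_le_eq card_gt_0_iff)
    finally show ?thesis by (simp add: mult.commute)
  qed
  have "(\<Sum>S\<in>Pow X. x S) = (\<Sum>S\<in>{S. S \<subseteq> X \<and> card S \<le> l}. x S)"
    by (rule sum.mono_neutral_right) (use X(1) x(3) in \<open>auto intro: leI\<close>)
  also have "\<dots> = (\<Sum>i\<le>l. \<Sum>S | S \<in> {S. S \<subseteq> X \<and> card S \<le> l} \<and> card S = i. x S)"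
    using X by (intro sum.group[symmetric]) auto
  also have "\<dots> = (\<Sum>i\<le>l. \<Sum>S | S \<subseteq> X \<and> card S = i. x S)"
    by (intro sum.cong) auto
  also have "\<dots> = (\<Sum>i<l. \<Sum>S | S \<subseteq> X \<and> card S = i. x S) + (\<Sum>S | S \<subseteq> X \<and> card S = l. x S)"
    by (simp add: lessThan_Suc_atMost[symmetric])
  also have "(\<Sum>S | S \<subseteq> X \<and> card S = l. x S) = c * (card X choose l)"
    using X x(1) by (simp add: n_subsets)
  also have "(\<Sum>i<l. \<Sum>S | S \<subseteq> X \<and> card S = i. x S) \<le> (\<Sum>i<l. p * card X ^ (l - 1))"
    using lt by (intro sum_mono) auto
  finally show ?thesis by simp
qed

text \<open>Disjoint blocks of size \<open>x S\<close> are embedded into \<open>{1..n}\<close>, and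
  \<open>F j\<close> is the union of the blocks whose label contains \<open>j\<close>. The blocks
  common to all \<open>F j\<close> with \<open>j\<close> in \<open>T\<close> are those labelled by
  supersets of \<open>T\<close>.\<close>

lemma sets_with_Venn_region_sizes:
  fixes x :: "'a set \<Rightarrow> nat"
  assumes X: "finite X" and le: "(\<Sum>S\<in>Pow X. x S) \<le> n"
  shows "\<exists>F. (\<forall>j\<in>X. F j \<subseteq> {1..n}) \<and>
    (\<forall>T\<subseteq>X. T \<noteq> {} \<longrightarrow> card (\<Inter>j\<in>T. F j) = (\<Sum>S | T \<subseteq> S \<and> S \<subseteq> X. x S))"
proof -
  define P where "P = Sigma (Pow X) (\<lambda>S. {..<x S})"
  have finP: "finite P" unfolding P_def using X by auto
  have "card P \<le> card {1..n}" using X le by (simp add: P_def)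
  then obtain e where e: "inj_on e P" "e ` P \<subseteq> {1..n}"
    using finP by (metis finite_atLeastAtMost inj_on_iff_card_le)
  define F where "F j = e ` {q \<in> P. j \<in> fst q}" for j
  have "card (\<Inter>j\<in>T. F j) = (\<Sum>S | T \<subseteq> S \<and> S \<subseteq> X. x S)"
    if T: "T \<subseteq> X" "T \<noteq> {}" for T
  proof -
    obtain t where "t \<in> T" using T by blast
    then have "(\<Inter>j\<in>T. F j) = e ` (\<Inter>j\<in>T. {q \<in> P. j \<in> fst q})"
      unfolding F_def by (intro image_INT[symmetric, OF e(1)]) auto
    also have "(\<Inter>j\<in>T. {q \<in> P. j \<in> fst q}) = Sigma {S. T \<subseteq> S \<and> S \<subseteq> X} (\<lambda>S. {..<x S})"
      using T by (auto simp: P_def)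
    also have "card (e ` \<dots>) = card (Sigma {S. T \<subseteq> S \<and> S \<subseteq> X} (\<lambda>S. {..<x S}))"
      by (intro card_image inj_on_subset[OF e(1)]) (auto simp: P_def)
    also have "\<dots> = (\<Sum>S | T \<subseteq> S \<and> S \<subseteq> X. x S)"
      using X by (subst card_SigmaI) (auto intro: finite_subset[of _ "Pow X"])
    finally show ?thesis .
  qed
  moreover have "F j \<subseteq> {1..n}" for j using e(2) by (auto simp: F_def)
  ultimately show ?thesis by blast
qed

text \<open>A number realising each entry. The value 1 for \<open>Star\<close> is nonzero modulo
  every prime and yields the same leading constant as \<open>Res 1\<close>.\<close>

fun entry_rep :: "entry \<Rightarrow> nat" where
  "entry_rep (Res a) = a"
| "entry_rep Star = 1"

lemma entry_holds_if_cong_rep: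
  assumes "p > 1" "[m = entry_rep e] (mod p)"
  shows "entry_holds p e m"
  using assms by (cases e) (auto simp: cong_def)

lemma max_intersecting_ge:
  assumes F: "\<F> \<subseteq> Pow {1..n}" "intersecting_mod p k \<alpha> \<F>"
  shows "card \<F> \<le> max_intersecting p k \<alpha> n"
proof -
  have "finite {\<F>. \<F> \<subseteq> Pow {1..n} \<and> intersecting_mod p k \<alpha> \<F>}"
    by (rule finite_subset[of _ "Pow (Pow {1..n})"]) auto
  then show ?thesis unfolding max_intersecting_def using F by (intro Max_ge) auto
qed

text \<open>The hypothesis on \<open>n\<close> provides room for all Venn regions of
  \<open>m\<close> sets. Their \<open>l\<close>-wise intersections have exactly
  \<open>entry_rep (\<alpha> l)\<close> points, and larger ones are empty.\<close>

lemma le_max_intersecting: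
  assumes p: "p > 1" and l: "l \<ge> 1" and nz: "\<alpha> l \<noteq> Res 0"
    and z: "\<forall>i\<in>{l+1..k}. \<alpha> i = Res 0"
    and m: "m > l"
    and n: "entry_rep (\<alpha> l) * (m choose l) + l * p * m ^ (l - 1) \<le> n"
  shows "m \<le> max_intersecting p k \<alpha> n"
proof -
  define c where "c = entry_rep (\<alpha> l)"
  have c: "c > 0" using nz unfolding c_def by (cases "\<alpha> l") auto
  define X where "X = {..<m}"
  have X: "finite X" "X \<noteq> {}" "card X = m" using m by (auto simp: X_def)
  \<comment> \<open>With \<open>d = l\<close> the condition \<open>l \<le> card T + d\<close> always
    holds, so every level below \<open>l\<close> is corrected.\<close>
  obtain x where x: "\<And>S. card S = l \<Longrightarrow> x S = c" "\<And>S. card S < l \<Longrightarrow> x S < p"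
    "\<And>S. card S > l \<Longrightarrow> x S = 0"
    and cg: "\<And>T. T \<subseteq> X \<Longrightarrow> card T < l \<Longrightarrow>
       [(\<Sum>S | T \<subseteq> S \<and> S \<subseteq> X. x S) = entry_rep (\<alpha> (card T))] (mod p)"
    using Venn_region_sizes[of p X l c l "\<lambda>i. entry_rep (\<alpha> i)"] p X by auto
  have "(\<Sum>S\<in>Pow X. x S) \<le> n"
    using sum_Venn_region_sizes_le[OF X(1,2), of l x c p] x n X by (simp add: c_def)
  then obtain F where F: "\<And>j. j \<in> X \<Longrightarrow> F j \<subseteq> {1..n}"
    and cardF: "\<And>T. T \<subseteq> X \<Longrightarrow> T \<noteq> {} \<Longrightarrow>
      card (\<Inter>j\<in>T. F j) = (\<Sum>S | T \<subseteq> S \<and> S \<subseteq> X. x S)"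
    using sets_with_Venn_region_sizes[OF X(1)] by meson
  have finT: "finite T" if "T \<subseteq> X" for T using that X finite_subset by blast
  have gt: "card (\<Inter>j\<in>T. F j) = 0" if T: "T \<subseteq> X" "card T > l" for T
  proof -
    have "x S = 0" if "T \<subseteq> S" "S \<subseteq> X" for S
      using card_mono[OF finT[OF that(2)] that(1)] T by (intro x(3)) simp
    moreover have "T \<noteq> {}" using T by auto
    ultimately show ?thesis using cardF T by simp
  qed
  have eq: "card (\<Inter>j\<in>T. F j) = c" if T: "T \<subseteq> X" "card T = l" for T
  proof -
    have "(\<Sum>S | T \<subseteq> S \<and> S \<subseteq> X. x S) = (\<Sum>S\<in>{T}. x S)"
    proof (rule sum.mono_neutral_right)
      show "finite {S. T \<subseteq> S \<and> S \<subseteq> X}"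
        by (rule finite_subset[of _ "Pow X"]) (use X in auto)
      show "{T} \<subseteq> {S. T \<subseteq> S \<and> S \<subseteq> X}" using T by blast
      show "\<forall>S\<in>{S. T \<subseteq> S \<and> S \<subseteq> X} - {T}. x S = 0"
      proof
        fix S assume "S \<in> {S. T \<subseteq> S \<and> S \<subseteq> X} - {T}"
        then have "T \<subset> S" "S \<subseteq> X" by auto
        then have "card T < card S" using psubset_card_mono finT by blast
        then show "x S = 0" using T x(3) by simp
      qed
    qed
    moreover have "T \<noteq> {}" using T l by auto
    ultimately show ?thesis using cardF T x(1) by simp
  qed
  have inj: "inj_on F X"
  proof (rule inj_onI, rule ccontr)
    fix i j assume ij: "i \<in> X" "j \<in> X" "F i = F j" "i \<noteq> j"
    \<comment> \<open>\<open>m > l\<close> leaves \<open>l - 1\<close> further indices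
      \<open>U\<close>. If \<open>F i = F j\<close>, adjoining \<open>j\<close> to
      \<open>insert i U\<close> would not change the intersection, whose size must drop from
      \<open>c > 0\<close> to 0.\<close>
    have "l - 1 \<le> card (X - {i, j})" using X ij m by (simp add: card_Diff_subset)
    then obtain U where U: "U \<subseteq> X - {i, j}" "card U = l - 1" "finite U"
      by (rule obtain_subset_with_card_n)
    have nin: "i \<notin> U" "j \<notin> U" using U by auto
    have "card (insert i U) = l" using U nin l by simp
    moreover have "card (insert j (insert i U)) = Suc l" using U nin ij l by simp
    moreover have "insert i U \<subseteq> X" "insert j (insert i U) \<subseteq> X" using U ij by auto
    ultimately have "card (\<Inter>t\<in>insert i U. F t) = c" "card (\<Inter>t\<in>insert j (insert i U). F t) = 0"
      by (auto intro!: eq gt simp del: INT_insert Inf_insert image_insert)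
    moreover have "(\<Inter>t\<in>insert j (insert i U). F t) = (\<Inter>t\<in>insert i U. F t)" using ij(3) by auto
    ultimately show False using c by simp
  qed
  have "intersecting_mod p k \<alpha> (F ` X)"
    unfolding intersecting_mod_def
  proof (intro ballI allI impI)
    fix i \<G> assume i: "i \<in> {1..k}" and G: "\<G> \<subseteq> F ` X \<and> card \<G> = i"
    then obtain T where T: "T \<subseteq> X" "\<G> = F ` T" by (meson subset_imageE)
    \<comment> \<open>Injectivity turns a choice of \<open>i\<close> distinct members into a choice
      of \<open>i\<close> indices.\<close>
    have cT: "card T = i" using G T card_image[OF inj_on_subset[OF inj T(1)]] by simp
    then have ne: "T \<noteq> {}" using i by auto
    consider "i < l" | "i = l" | "i > l" by linarith
    then show "entry_holds p (\<alpha> i) (card (\<Inter>\<G>))"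
    proof cases
      case 1
      then show ?thesis using cg[OF T(1)] cardF[OF T(1) ne] cT T(2) p
        by (intro entry_holds_if_cong_rep) auto
    next
      case 2
      then show ?thesis using eq[OF T(1)] cT T(2) p
        by (intro entry_holds_if_cong_rep) (auto simp: c_def)
    next
      case 3
      then show ?thesis using gt[OF T(1)] cT T(2) z i by simp
    qed
  qed
  moreover have "F ` X \<subseteq> Pow {1..n}" using F by auto
  ultimately have "card (F ` X) \<le> max_intersecting p k \<alpha> n"
    by (intro max_intersecting_ge)
  then show ?thesis using card_image[OF inj] X by simp
qed

section \<open>Asymptotics\<close>

text \<open>For a family of size \<open>f > l\<close>, \<open>(f - l) ^ l\<close> is at most
  \<open>fact l * (f choose l)\<close>, hence at most \<open>fact l * n\<close>; taking roots costs
  only the additive \<open>l\<close>.\<close>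

lemma max_intersecting_le_root:
  assumes "prime p" "l \<ge> 1" "k \<ge> 2 * l" "\<alpha> l \<in> entries p" "\<alpha> l \<noteq> Res 0"
    "\<forall>i\<in>{l+1..k}. \<alpha> i = Res 0"
  shows "real (max_intersecting p k \<alpha> n) \<le> (fact l * real n) powr (1 / real l) + real l"
proof -
  define f where "f = max_intersecting p k \<alpha> n"
  obtain \<F> where F: "\<F> \<subseteq> Pow {1..n}" "intersecting_mod p k \<alpha> \<F>" "card \<F> = f"
    using max_intersecting_attained unfolding f_def by blast
  have ch: "f choose l \<le> n"
    using choose_card_intersecting_le[OF assms F(1,2)] F(3) by simp
  show ?thesis unfolding f_def[symmetric]
  proof (cases "f \<le> l")
    case True
    then show "real f \<le> (fact l * real n) powr (1 / real l) + real l"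
      by (smt (verit) of_nat_mono powr_ge_zero)
  next
    case False
    have "(f - l) ^ l \<le> fact l * (f choose l)"
      using power_le_fact_mult_binomial[of "f - l" l] False by simp
    also have "\<dots> \<le> fact l * n" using ch by simp
    finally have "real ((f - l) ^ l) \<le> real (fact l * n)" by (rule of_nat_mono)
    then have "real (f - l) ^ l \<le> fact l * real n" by simp
    then have "(real (f - l) powr real l) powr (1 / real l) \<le> (fact l * real n) powr (1 / real l)"
      using False by (intro powr_mono2) (auto simp: powr_realpow)
    then have "real (f - l) \<le> (fact l * real n) powr (1 / real l)"
      using assms(2) False by (simp add: powr_powr)
    then show "real f \<le> (fact l * real n) powr (1 / real l) + real l"
      using False by linarith
  qed
qed

text \<open>Absorbs a term of order \<open>l - 1\<close> into a constant shift of the base.\<close>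

lemma power_add_power_le:
  fixes a d :: nat
  shows "l \<ge> 1 \<Longrightarrow> a ^ l + d * a ^ (l - 1) \<le> (a + d) ^ l"
proof (induction l rule: dec_induct)
  case (step l)
  have "a ^ l * (a + d) \<le> (a + d) ^ l * (a + d)"
    by (intro mult_le_mono power_mono) auto
  then show ?case by (simp add: algebra_simps)
qed simp

text \<open>The lower-order point count costs only a constant shift of \<open>m\<close>, so the loss
  against the root is additive and bounded.\<close>

lemma root_le_max_intersecting:
  assumes p: "p > 1" and l: "l \<ge> 1" and nz: "\<alpha> l \<noteq> Res 0"
    and z: "\<forall>i\<in>{l+1..k}. \<alpha> i = Res 0"
  shows "\<exists>C. \<forall>n. (fact l * real n / entry_rep (\<alpha> l)) powr (1 / real l) - C
    \<le> real (max_intersecting p k \<alpha> n)"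
proof -
  define c where "c = entry_rep (\<alpha> l)"
  have c: "c > 0" using nz unfolding c_def by (cases "\<alpha> l") auto
  \<comment> \<open>Chosen so that \<open>fact l\<close> times the error term
    \<open>l * p * m ^ (l - 1)\<close> is \<open>d * m ^ (l - 1)\<close>.\<close>
  define d where "d = fact l * (l * p)"
  \<comment> \<open>The loss consists of the shift \<open>d\<close>, 1 for the floor, and
    \<open>l\<close> to make the bound trivial when \<open>m \<le> l\<close>.\<close>
  have "(fact l * real n / c) powr (1 / real l) - real (d + l + 1)
    \<le> real (max_intersecting p k \<alpha> n)" for n
  proof -
    define y where "y = (fact l * real n / c) powr (1 / real l)"
    have y0: "y \<ge> 0" by (simp add: y_def)
    have yl: "y ^ l = fact l * real n / c"
    proof (cases "n = 0")
      case True
      then show ?thesis using l by (simp add: y_def)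
    next
      case False
      then have "y > 0" using c by (simp add: y_def)
      then have "y ^ l = y powr real l" by (simp add: powr_realpow)
      also have "\<dots> = fact l * real n / c" using l c by (simp add: y_def powr_powr)
      finally show ?thesis .
    qed
    define m where "m = nat \<lfloor>y\<rfloor> - d"
    have my: "y - real d - 1 \<le> real m" unfolding m_def by linarith
    show ?thesis
    proof (cases "m > l")
      case False
      then show ?thesis using my unfolding y_def[symmetric] by linarith
    next
      case True
      then have "real (m + d) \<le> y" unfolding m_def using y0 by linarith
      then have "real (m + d) ^ l \<le> fact l * real n / c"
        unfolding yl[symmetric] by (intro power_mono) auto
      then have "real c * real (m + d) ^ l \<le> fact l * real n"
        using c by (simp add: field_simps)
      then have "real (c * (m + d) ^ l) \<le> real (fact l * n)" by simp
      then have le: "c * (m + d) ^ l \<le> fact l * n" by (simp only: of_nat_le_iff)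
      have "fact l * (c * (m choose l) + l * p * m ^ (l - 1))
          = c * ((m choose l) * fact l) + d * m ^ (l - 1)"
        by (simp add: d_def algebra_simps)
      also have "\<dots> \<le> c * m ^ l + c * (d * m ^ (l - 1))"
      proof (rule add_mono)
        show "c * ((m choose l) * fact l) \<le> c * m ^ l"
          using binomial_fact_pow by (intro mult_le_mono le_refl)
        show "d * m ^ (l - 1) \<le> c * (d * m ^ (l - 1))"
          using mult_le_mono1[of 1 c] c by simp
      qed
      also have "\<dots> = c * (m ^ l + d * m ^ (l - 1))"
        by (simp add: algebra_simps)
      also have "\<dots> \<le> c * (m + d) ^ l"
        using power_add_power_le[OF l] by (intro mult_le_mono) auto
      also note le
      finally have "c * (m choose l) + l * p * m ^ (l - 1) \<le> n" by simp
      then have "m \<le> max_intersecting p k \<alpha> n"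
        using le_max_intersecting[OF p l nz z True] by (simp add: c_def)
      then show ?thesis using my unfolding y_def[symmetric] by linarith
    qed
  qed
  then show ?thesis unfolding c_def by blast
qed

text \<open>As \<open>g\<close> tends to infinity, the additive errors are eventually swallowed by
  multiples of \<open>g\<close>.\<close>

lemma bigtheta_if_between:
  fixes f g :: "nat \<Rightarrow> real"
  assumes g: "filterlim g at_top at_top" and c: "c > 0"
    and upper: "\<And>n. f n \<le> g n + C" and lower: "\<And>n. c * g n - D \<le> f n"
  shows "f \<in> \<Theta>(g)"
proof (rule bigthetaI)
  \<comment> \<open>The three thresholds make \<open>g\<close> positive, give
    \<open>f n \<le> 2 * g n\<close>, and give \<open>f n \<ge> c / 2 * g n\<close>.\<close>
  have big: "eventually (\<lambda>n. g n \<ge> max (max 1 \<bar>C\<bar>) (2 * \<bar>D\<bar> / c)) at_top"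
    using g unfolding filterlim_at_top by blast
  have D: "\<bar>D\<bar> \<le> c / 2 * g n" if "g n \<ge> 2 * \<bar>D\<bar> / c" for n
    using that c by (simp add: field_simps)
  show "f \<in> O(g)"
  proof (rule landau_o.bigI[of 2])
    show "eventually (\<lambda>n. norm (f n) \<le> 2 * norm (g n)) at_top"
      using big
    proof eventually_elim
      case (elim n)
      moreover have "0 \<le> c / 2 * g n" using c elim by simp
      moreover have "f n \<ge> 0" using lower[of n] D[of n] elim calculation by auto
      ultimately show ?case using upper[of n] by auto
    qed
  qed simp
  show "f \<in> \<Omega>(g)"
  proof (rule landau_omega.bigI[of "c / 2"])
    show "eventually (\<lambda>n. norm (f n) \<ge> c / 2 * norm (g n)) at_top"
      using big
    proof eventually_elim
      case (elim n)
      have "c / 2 * g n \<le> f n" using lower[of n] D[of n] elim by auto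
      then show ?case using elim by auto
    qed
  qed (use c in simp)
qed

text \<open>The ratio is squeezed between \<open>1 - D / g n\<close> and
  \<open>1 + C / g n\<close>.\<close>

lemma asymp_equiv_if_between:
  fixes f g :: "nat \<Rightarrow> real"
  assumes g: "filterlim g at_top at_top"
    and upper: "\<And>n. f n \<le> g n + C" and lower: "\<And>n. g n - D \<le> f n"
  shows "f \<sim>[at_top] g"
proof (rule asymp_equivI')
  have pos: "eventually (\<lambda>n. g n > 0) at_top"
    using g unfolding filterlim_at_top_dense by blast
  have lim: "((\<lambda>n. 1 + a / g n) \<longlongrightarrow> 1) at_top" for a
    using tendsto_add[OF tendsto_const tendsto_divide_0[OF tendsto_const
      filterlim_at_top_imp_at_infinity[OF g]], of 1 a] by simp
  show "((\<lambda>n. f n / g n) \<longlongrightarrow> 1) at_top"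
  proof (rule tendsto_sandwich[OF _ _ lim[of "- D"] lim[of C]])
    show "eventually (\<lambda>n. 1 + - D / g n \<le> f n / g n) at_top"
      using pos
    proof eventually_elim
      case (elim n)
      then have "1 + - D / g n = (g n - D) / g n" by (simp add: field_simps)
      also have "\<dots> \<le> f n / g n" using lower elim by (intro divide_right_mono) auto
      finally show ?case .
    qed
    show "eventually (\<lambda>n. f n / g n \<le> 1 + C / g n) at_top"
      using pos
    proof eventually_elim
      case (elim n)
      then have "f n / g n \<le> (g n + C) / g n" using upper by (intro divide_right_mono) auto
      also have "\<dots> = 1 + C / g n" using elim by (simp add: field_simps)
      finally show ?case .
    qed
  qed
qed

theorem theoremA5:
  fixes p l k :: nat and \<alpha> :: "nat \<Rightarrow> entry"
  assumes "prime p"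
    and "l \<ge> 1"
    and "k \<ge> 2 * l"
    and "\<forall>i\<in>{1..k}. \<alpha> i \<in> entries p"
    and "\<alpha> l \<noteq> Res 0"
    and "\<forall>i\<in>{l+1..k}. \<alpha> i = Res 0"
  shows "(\<lambda>n. real (max_intersecting p k \<alpha> n)) \<in> \<Theta>(\<lambda>n. real n powr (1 / real l)) \<and>
    (\<alpha> l = Res 1 \<or> \<alpha> l = Star \<longrightarrow>
       (\<lambda>n. real (max_intersecting p k \<alpha> n)) \<sim>[at_top]
         (\<lambda>n. (fact l * real n) powr (1 / real l)))"
proof -
  define f where "f n = real (max_intersecting p k \<alpha> n)" for n
  define g where "g n = (fact l * real n) powr (1 / real l)" for n
  \<comment> \<open>The ratio of the leading constants in the lower and upper bounds.\<close>
  define c where "c = (1 / real (entry_rep (\<alpha> l))) powr (1 / real l)"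
  have rep: "entry_rep (\<alpha> l) > 0" using assms(5) by (cases "\<alpha> l") auto
  have c: "c > 0" using rep by (simp add: c_def)
  have "\<alpha> l \<in> entries p" using assms(2-4) by simp
  note upper = max_intersecting_le_root[OF assms(1-3) this assms(5,6), folded f_def g_def]
  obtain D where "(fact l * real n / entry_rep (\<alpha> l)) powr (1 / real l) - D \<le> f n" for n
    using root_le_max_intersecting[OF prime_gt_1_nat[OF assms(1)] assms(2,5,6)]
    unfolding f_def by blast
  moreover have "(fact l * real n / entry_rep (\<alpha> l)) powr (1 / real l) = c * g n" for n
    by (simp add: c_def g_def powr_mult[symmetric] mult.commute)
  ultimately have lower: "c * g n - D \<le> f n" for n by simp
  have g_eq: "g = (\<lambda>n. fact l powr (1 / real l) * real n powr (1 / real l))"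
    unfolding g_def by (simp add: powr_mult)
  have "filterlim (\<lambda>n. real n powr (1 / real l)) at_top at_top"
    unfolding filterlim_at_top
  proof
    fix Z :: real
    \<comment> \<open>Replacing \<open>Z\<close> by \<open>max 1 Z\<close> keeps the base positive,
      so taking the root recovers it.\<close>
    have "eventually (\<lambda>n. real n \<ge> max 1 Z powr real l) at_top"
      using filterlim_real_sequentially unfolding filterlim_at_top by blast
    then show "eventually (\<lambda>n. Z \<le> real n powr (1 / real l)) at_top"
    proof eventually_elim
      case (elim n)
      then have "(max 1 Z powr real l) powr (1 / real l) \<le> real n powr (1 / real l)"
        by (intro powr_mono2) auto
      then show ?case using assms(2) by (simp add: powr_powr)
    qed
  qed
  then have g_lim: "filterlim g at_top at_top"
    unfolding g_eq by (intro filterlim_tendsto_pos_mult_at_top[OF tendsto_const]) simp_all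
  have "f \<in> \<Theta>(g)"
    using bigtheta_if_between[OF g_lim c upper lower] .
  also have "\<Theta>(g) = \<Theta>(\<lambda>n. real n powr (1 / real l))"
    unfolding g_eq by simp
  finally have "f \<in> \<Theta>(\<lambda>n. real n powr (1 / real l))" .
  moreover have "f \<sim>[at_top] g" if "\<alpha> l = Res 1 \<or> \<alpha> l = Star"
  proof -
    \<comment> \<open>Both entries have representative 1, so the two bounds differ only by additive
      constants.\<close>
    have "c = 1" using that by (auto simp: c_def)
    then show ?thesis using asymp_equiv_if_between[OF g_lim upper, of D] lower by simp
  qed
  ultimately show ?thesis unfolding f_def g_def by blast
qed

end
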